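(* Let $q=n-k$, write $\mathbb R^n=\mathbb R^k\times\mathbb R^q$, and let $B\colon\mathbb R^q\to\mathrm{Hom}(\mathbb R^k,\mathbb R^q)$ be continuous. For $y\in\mathbb R^q$ let $P_y=\{(t,\,y+B(y)t): t\in\mathbb R^k\}$ (oriented via $\mathbb R^k$), let $A(y)\in\mathrm{Hom}(\mathbb R^{k+1},\mathbb R^q)$ be $A(y)(t,\lambda)=B(y)t+\lambda y$, and let $d(y)$ be the distance from the origin of $\mathbb R^n$ to $P_y$. Then the planes $P_y$, $y\in\mathbb R^q$, are the fibers of a skew fibration of $\mathbb R^n$ if and only if (i) for every pair of distinct points $x,y\in\mathbb R^q$, $\mathrm{Ker}(A(x)-A(y))=0$, and (ii) whenever $x_n$ is a sequence in $\mathbb R^q$ with no accumulation points, $d(x_n)\to\infty$. Conversely, every skew fibration of $\mathbb R^n$ by oriented affine $k$-planes which admits an affine $q$-plane transverse to all fibers can be described in this way by such a $B$, after an isometric change of coordinates identifying that transverse plane with $\{0\}\times\mathbb R^q$.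
   Context: A fibration of $\mathbb R^n$ by oriented affine $k$-planes is a family of pairwise disjoint oriented affine $k$-planes covering $\mathbb R^n$ such that the map sending a point to the fiber through it is continuous. It is skew if no two distinct fibers contain parallel lines. Two affine subspaces are transverse if their parallel linear subspaces meet only in $0$. *)

theory Defs
  imports "HOL-Analysis.Analysis"
begin

definition frame :: "('k::finite \<Rightarrow> 'a::euclidean_space) \<Rightarrow> bool" where
  "frame f \<longleftrightarrow> inj f \<and> independent (range f)"

text \<open>Two frames of the same linear subspace have the same orientation iff the
  matrix of mutual inner products has positive determinant.  An oriented affine
  k-plane is encoded as the pair (point set, set of positively oriented frames of
  its direction space).\<close>
definition oplane :: "'a::euclidean_space \<Rightarrow> ('k::finite \<Rightarrow> 'a) \<Rightarrow> 'a set \<times> ('k \<Rightarrow> 'a) set" where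
  "oplane p f = ((\<lambda>v. p + v) ` span (range f),
                 {g. frame g \<and> span (range g) = span (range f) \<and>
                     det (\<chi> i j. g i \<bullet> f j) > 0})"

definition oriented_planes :: "('a::euclidean_space set \<times> ('k::finite \<Rightarrow> 'a) set) set" where
  "oriented_planes = {oplane p f | p f. frame f}"

text \<open>Open sets of the standard (quotient) topology on oriented affine k-planes:
  those whose preimage in the space of representatives (point, frame) is open.\<close>
definition oplane_open :: "('a::euclidean_space set \<times> ('k::finite \<Rightarrow> 'a) set) set \<Rightarrow> bool" where
  "oplane_open U \<longleftrightarrow> U \<subseteq> oriented_planes \<and>
     openin (top_of_set (UNIV \<times> {f. frame f}))
            {r \<in> UNIV \<times> {f. frame f}. oplane (fst r) (snd r) \<in> U}"

definition fibration :: "('a::euclidean_space set \<times> ('k::finite \<Rightarrow> 'a) set) set \<Rightarrow> bool" where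
  "fibration F \<longleftrightarrow> F \<subseteq> oriented_planes
     \<and> (\<forall>P\<in>F. \<forall>Q\<in>F. P \<noteq> Q \<longrightarrow> fst P \<inter> fst Q = {})
     \<and> (\<forall>x. \<exists>P\<in>F. x \<in> fst P)
     \<and> (\<forall>U. oplane_open U \<longrightarrow> open ((\<lambda>x. THE P. P \<in> F \<and> x \<in> fst P) -` U))"

definition skew :: "('a::euclidean_space set \<times> ('k::finite \<Rightarrow> 'a) set) set \<Rightarrow> bool" where
  "skew F \<longleftrightarrow> (\<forall>P\<in>F. \<forall>Q\<in>F. P \<noteq> Q \<longrightarrow>
      \<not> (\<exists>a b v. v \<noteq> 0 \<and> (\<forall>t. a + t *\<^sub>R v \<in> fst P) \<and> (\<forall>t. b + t *\<^sub>R v \<in> fst Q)))"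

definition lin_dir :: "'a::real_vector set \<Rightarrow> 'a set" where
  "lin_dir S = {x - y | x y. x \<in> S \<and> y \<in> S}"

definition transverse :: "'a::real_vector set \<Rightarrow> 'a set \<Rightarrow> bool" where
  "transverse S T \<longleftrightarrow> lin_dir S \<inter> lin_dir T = {0}"

definition Pl :: "(real^'q::finite \<Rightarrow> real^'k::finite^'q) \<Rightarrow> real^'q
                   \<Rightarrow> ((real^'k) \<times> (real^'q)) set \<times> ('k \<Rightarrow> (real^'k) \<times> (real^'q)) set" where
  "Pl B y = oplane (0, y) (\<lambda>i. (axis i 1, B y *v axis i 1))"

definition Amap :: "(real^'q::finite \<Rightarrow> real^'k::finite^'q) \<Rightarrow> real^'q \<Rightarrow> (real^'k) \<times> real \<Rightarrow> real^'q" where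
  "Amap B y = (\<lambda>(t, l). B y *v t + l *\<^sub>R y)"

definition transport :: "('a::real_vector \<Rightarrow> 'a) \<Rightarrow> 'a set \<times> ('k \<Rightarrow> 'a) set \<Rightarrow> 'a set \<times> ('k \<Rightarrow> 'a) set" where
  "transport h P = (h ` fst P, (\<lambda>g i. h (g i) - h 0) ` snd P)"

end

theory Submission
  imports Defs
begin

text \<open>The planes \<open>P\<^sub>y\<close> are pairwise disjoint and cover the space iff the map \<open>(t, y) \<mapsto> (t, y + B(y) t)\<close> is a
  bijection.  A kernel vector \<open>(t, \<lambda>)\<close> of \<open>A(x) - A(y)\<close> is a common point of \<open>P\<^sub>x\<close> and \<open>P\<^sub>y\<close> if
  \<open>\<lambda> \<noteq> 0\<close> and a common direction if \<open>\<lambda> = 0\<close>, so (i) amounts to injectivity together with skewness.  Given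
  injectivity, the range is open by invariance of domain, and (ii) makes it closed, hence everything.
  Conversely a continuous bijection is a homeomorphism, so the planes meeting a fixed ball have base
  points in a compact set, which is (ii).

  In the presence of a transverse \<open>q\<close>-plane, choose an isometry taking \<open>{0} \<times> \<real>\<^sup>q\<close> to it.  In these
  coordinates every fiber is a graph over \<open>\<real>\<^sup>k\<close>.  Its orientation relative to \<open>\<real>\<^sup>k\<close> is locally constant,
  hence constant, and is made positive by composing with a reflection of \<open>\<real>\<^sup>k\<close>.  The slope of the graph is
  continuous on the space of oriented planes where it is defined.\<close>

section \<open>Frames and oriented planes\<close>

text \<open>Treats a tuple as a linear map on \<open>real^'k\<close>, so that spans become ranges
  and independence becomes a trivial kernel.\<close>

definition comb :: "('k::finite \<Rightarrow> 'a::real_vector) \<Rightarrow> real^'k \<Rightarrow> 'a" where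
  "comb f c = (\<Sum>i\<in>UNIV. (c $ i) *\<^sub>R f i)"

lemma linear_comb: "linear (comb f)"
  by (rule linearI) (simp_all add: comb_def sum.distrib scaleR_add_left scaleR_sum_right)

lemma comb_axis [simp]: "comb f (axis i 1) = f i"
proof -
  have "comb f (axis i 1) = (\<Sum>j\<in>UNIV. if j = i then f j else 0)"
    unfolding comb_def by (rule sum.cong) (auto simp: axis_def)
  then show ?thesis by simp
qed

lemma linear_eq_comb:
  fixes g :: "real^'k::finite \<Rightarrow> 'a::real_vector"
  assumes "linear g"
  shows "g c = comb (\<lambda>i. g (axis i 1)) c"
proof -
  have "g c = g (\<Sum>i\<in>UNIV. (c $ i) *\<^sub>R axis i 1)"
    using basis_expansion[of c] by (simp add: scalar_mult_eq_scaleR)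
  then show ?thesis
    by (simp add: comb_def linear_sum[OF assms] linear_scale[OF assms])
qed

lemma linear_comb_image: "linear L \<Longrightarrow> L (comb f c) = comb (L \<circ> f) c"
  by (simp add: comb_def linear_sum linear_scale)

text \<open>The rows of \<open>C\<close> are the coordinates of the new vectors in the old tuple.
  Both sides are linear in \<open>c\<close>, so comparing them on the standard basis is
  enough.\<close>

lemma comb_comb: "comb (\<lambda>i. comb f (C $ i)) c = comb f (c v* C)"
proof -
  have "linear (\<lambda>c. comb f (c v* C))"
    by (intro linearI)
      (simp_all add: vector_matrix_left_distrib scaleR_vector_matrix_assoc linear_add[OF linear_comb] linear_scale[OF linear_comb])
  moreover have "axis i 1 v* C = C $ i" for i
    by (simp add: vec_eq_iff vector_matrix_mult_def axis_def if_distrib[of "\<lambda>x. x * _"] cong: if_cong)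
  ultimately show ?thesis by (subst linear_eq_comb[of "\<lambda>c. comb f (c v* C)"]) auto
qed

lemma span_range_eq: "span (range f) = range (comb f)"
proof
  show "span (range f) \<subseteq> range (comb f)"
  proof (rule span_minimal)
    show "range f \<subseteq> range (comb f)" by (metis comb_axis image_subsetI rangeI)
    show "subspace (range (comb f))"
      using linear_comb linear_subspace_image subspace_UNIV by blast
  qed
  show "range (comb f) \<subseteq> span (range f)"
    unfolding comb_def by (intro image_subsetI span_sum span_scale span_base rangeI)
qed

lemma frame_iff: "frame f \<longleftrightarrow> (\<forall>c. comb f c = 0 \<longrightarrow> c = 0)"
proof
  assume fr: "frame f"
  show "\<forall>c. comb f c = 0 \<longrightarrow> c = 0"
  proof (intro allI impI)
    fix c assume c: "comb f c = 0"
    have inj: "inj f" and ind: "independent (range f)" using fr by (auto simp: frame_def)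
    have "(\<Sum>v\<in>range f. (c $ inv f v) *\<^sub>R v) = comb f c"
      using inj by (simp add: sum.reindex comb_def)
    then have *: "(\<Sum>v\<in>range f. (c $ inv f v) *\<^sub>R v) = 0" using c by simp
    have "c $ i = 0" for i
      using independentD[OF ind finite_imageI[OF finite] subset_refl *, of "f i"] inj by simp
    then show "c = 0" by (simp add: vec_eq_iff)
  qed
next
  assume ker: "\<forall>c. comb f c = 0 \<longrightarrow> c = 0"
  have inj: "inj f"
  proof (rule injI)
    \<comment> \<open>A repeated entry would put a difference of two basis vectors into the
      kernel.\<close>
    fix i j assume "f i = f j"
    then have "comb f (axis i 1 - axis j 1) = 0"
      by (simp add: linear_diff[OF linear_comb])
    then have "axis i (1::real) = axis j 1" using ker by fastforce
    then show "i = j" by (simp add: axis_eq_axis)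
  qed
  moreover have "independent (range f)"
  proof (rule ccontr)
    assume "\<not> independent (range f)"
    then obtain u v where u: "(\<Sum>v\<in>range f. u v *\<^sub>R v) = 0" and v: "v \<in> range f" "u v \<noteq> 0"
      by (auto simp: dependent_finite)
    from u have "comb f (\<chi> i. u (f i)) = 0"
      using inj by (simp add: sum.reindex comb_def)
    then have "(\<chi> i. u (f i)) = 0" using ker by blast
    with v show False by (auto simp: vec_eq_iff)
  qed
  ultimately show "frame f" by (simp add: frame_def)
qed

section \<open>Determinants, Gram matrices and changes of frame\<close>

lemma continuous_on_det:
  fixes A :: "'a::topological_space \<Rightarrow> real^'n::finite^'n"
  assumes "continuous_on S A"
  shows "continuous_on S (\<lambda>x. det (A x))"
  unfolding det_def by (intro continuous_intros assms)

text \<open>The determinant does not vanish along the segment from the identity matrix to \<open>A\<close>.\<close>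
lemma det_pos_definite:
  fixes A :: "real^'n::finite^'n"
  assumes "\<And>x. x \<noteq> 0 \<Longrightarrow> x \<bullet> (A *v x) > 0"
  shows "det A > 0"
proof -
  define g where "g s = det ((1 - s) *\<^sub>R mat 1 + s *\<^sub>R A)" for s :: real
  have cont: "continuous_on {0..1} g"
    unfolding g_def by (intro continuous_on_det continuous_intros)
  have nz: "g s \<noteq> 0" if "s \<in> {0..1}" for s
  proof
    assume "g s = 0"
    then have "\<not> invertible ((1 - s) *\<^sub>R mat 1 + s *\<^sub>R A)"
      by (simp add: g_def invertible_det_nz)
    then obtain x where x: "x \<noteq> 0" "((1 - s) *\<^sub>R mat 1 + s *\<^sub>R A) *v x = 0"
      by (metis invertible_left_inverse matrix_left_invertible_ker)
    \<comment> \<open>The quadratic form is a convex combination of two positive numbers, so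
      \<open>x\<close> cannot lie in the kernel.\<close>
    have "x \<bullet> (((1 - s) *\<^sub>R mat 1 + s *\<^sub>R A) *v x) = (1 - s) * (x \<bullet> x) + s * (x \<bullet> (A *v x))"
      by (simp add: matrix_vector_mult_add_rdistrib scaleR_matrix_vector_assoc[symmetric] inner_add_right)
    moreover have "x \<bullet> x > 0" "x \<bullet> (A *v x) > 0" using x assms by auto
    moreover have "(1 - s) * (x \<bullet> x) + s * (x \<bullet> (A *v x)) > 0"
    proof (cases "s = 0")
      case False
      then show ?thesis using that \<open>x \<bullet> x > 0\<close> \<open>x \<bullet> (A *v x) > 0\<close>
        by (intro add_nonneg_pos mult_nonneg_nonneg mult_pos_pos) auto
    qed (use x in auto)
    ultimately show False using x by simp
  qed
  have "g 0 = 1" by (simp add: g_def)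
  have "g 1 > 0"
  proof (rule ccontr)
    assume "\<not> g 1 > 0"
    then have "\<exists>s\<ge>0. s \<le> 1 \<and> g s = 0"
      using \<open>g 0 = 1\<close> by (intro IVT2' cont) auto
    with nz show False by auto
  qed
  then show ?thesis by (simp add: g_def)
qed

lemma comb_inner: "comb f x \<bullet> comb g y = x \<bullet> ((\<chi> i j. f i \<bullet> g j) *v y)"
proof -
  have "comb f x \<bullet> comb g y = (\<Sum>i\<in>UNIV. x $ i * (\<Sum>j\<in>UNIV. y $ j * (f i \<bullet> g j)))"
    unfolding comb_def by (simp only: inner_sum_left inner_scaleR_left) (simp add: inner_sum_right)
  then show ?thesis
    by (simp add: inner_vec_def matrix_vector_mult_def mult.commute)
qed

text \<open>The quadratic form of the Gram matrix at \<open>x\<close> is the squared norm of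
  \<open>comb f x\<close>, which independence makes positive for
  \<open>x \<noteq> 0\<close>.\<close>

lemma det_gram_pos: "frame f \<Longrightarrow> det (\<chi> i j. f i \<bullet> f j) > 0"
  by (rule det_pos_definite) (auto simp: comb_inner[symmetric] frame_iff)

lemma gram_comb_left: "(\<chi> i j. comb f (C $ i) \<bullet> g j) = C ** (\<chi> i j. f i \<bullet> g j)"
  by (simp add: vec_eq_iff comb_def matrix_matrix_mult_def inner_sum_left)

lemma gram_comb_right: "(\<chi> i j. f i \<bullet> comb g (C $ j)) = (\<chi> i j. f i \<bullet> g j) ** transpose C"
  by (simp add: vec_eq_iff comb_def matrix_matrix_mult_def inner_sum_right transpose_def mult.commute)

lemma matrix_inv_right: "invertible A \<Longrightarrow> A ** matrix_inv A = mat 1"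
  and matrix_inv_left: "invertible A \<Longrightarrow> matrix_inv A ** A = mat 1"
  unfolding matrix_inv_def invertible_def
  by (metis (mono_tags, lifting) someI_ex)+

lemma range_comb_comb:
  fixes C :: "real^'k::finite^'k"
  assumes "det C \<noteq> 0"
  shows "range (comb (\<lambda>i. comb f (C $ i))) = range (comb f)"
proof -
  have "surj (\<lambda>c. c v* C)"
  proof (rule surjI)
    fix c
    show "(c v* matrix_inv C) v* C = c"
      using assms by (simp add: vector_matrix_mul_assoc matrix_inv_left invertible_det_nz)
  qed
  then show ?thesis by (force simp: comb_comb)
qed

lemma frame_comb:
  fixes C :: "real^'k::finite^'k"
  assumes "frame f" "det C \<noteq> 0"
  shows "frame (\<lambda>i. comb f (C $ i))"
  unfolding frame_iff comb_comb
proof (intro allI impI)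
  fix c assume "comb f (c v* C) = 0"
  then have "c v* C = 0" using assms(1) by (simp add: frame_iff)
  then have "(c v* C) v* matrix_inv C = 0" by simp
  then show "c = 0"
    using assms(2) by (simp add: vector_matrix_mul_assoc matrix_inv_right invertible_det_nz)
qed

section \<open>Representatives of oriented planes\<close>

lemma fst_oplane: "fst (oplane p f) = range (\<lambda>c. p + comb f c)"
  by (auto simp: oplane_def span_range_eq)

text \<open>An invertible \<open>C\<close> keeps the span, the shift \<open>comb f c\<close> stays
  inside it, and Gram determinants against the new frame only gain the positive factor
  \<open>det C\<close>.\<close>

lemma oplane_eqI:
  fixes C :: "real^'k::finite^'k"
  assumes "det C > 0"
  shows "oplane (p + comb f c) (\<lambda>i. comb f (C $ i)) = oplane p f"
proof -
  let ?f = "\<lambda>i. comb f (C $ i)"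
  have sp: "span (range ?f) = span (range f)"
    using assms by (simp add: span_range_eq range_comb_comb)
  have "(\<lambda>v. p + comb f c + v) ` span (range f) = (\<lambda>v. p + v) ` span (range f)"
  proof -
    have "(\<lambda>v. comb f c + v) ` range (comb f) = range (comb f)"
    proof -
      have "comb f c + comb f d \<in> range (comb f)" for d
        by (metis linear_add[OF linear_comb] rangeI)
      moreover have "comb f d \<in> (\<lambda>v. comb f c + v) ` range (comb f)" for d
        by (rule image_eqI[of _ _ "comb f (d - c)"]) (simp add: linear_diff[OF linear_comb], rule rangeI)
      ultimately show ?thesis by auto
    qed
    then have "(\<lambda>v. p + v) ` (\<lambda>v. comb f c + v) ` range (comb f) = (\<lambda>v. p + v) ` range (comb f)"
      by simp
    then show ?thesis by (simp add: span_range_eq image_image add.assoc)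
  qed
  moreover have "det (\<chi> i j. g i \<bullet> ?f j) > 0 \<longleftrightarrow> det (\<chi> i j. g i \<bullet> f j) > 0" for g
    using assms by (simp add: gram_comb_right det_mul zero_less_mult_iff)
  ultimately show ?thesis
    by (simp add: oplane_def sp)
qed

text \<open>A frame is positively oriented relative to itself, so \<open>f\<close> is among the
  frames recorded for \<open>oplane p' f'\<close>. Expanding \<open>f\<close> in \<open>f'\<close>
  gives \<open>C\<close>, and the mixed Gram determinant is \<open>det C\<close> times the positive
  Gram determinant of \<open>f'\<close>.\<close>

lemma oplane_eqD:
  assumes "frame f" "frame f'" "oplane p f = oplane p' f'"
  obtains C where "det C > 0" "f = (\<lambda>i. comb f' (C $ i))"
proof -
  have "f \<in> snd (oplane p f)"
    using assms(1) det_gram_pos[OF assms(1)] by (simp add: oplane_def)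
  then have f: "span (range f) = span (range f')" "det (\<chi> i j. f i \<bullet> f' j) > 0"
    using assms(3) by (auto simp: oplane_def)
  have "\<forall>i. \<exists>c. f i = comb f' c"
    using f(1) by (metis imageE rangeI span_base span_range_eq)
  then obtain c where c: "\<And>i. f i = comb f' (c i)" by metis
  define C where "C = (\<chi> i. c i)"
  have fC: "f = (\<lambda>i. comb f' (C $ i))" by (simp add: C_def c fun_eq_iff)
  have "det (\<chi> i j. f i \<bullet> f' j) = det C * det (\<chi> i j. f' i \<bullet> f' j)"
    unfolding fC gram_comb_left by (simp add: det_mul)
  then have "det C > 0"
    using f(2) det_gram_pos[OF assms(2)] by (simp add: zero_less_mult_iff)
  with fC that show ?thesis by blast
qed

text \<open>Source of all open sets of planes used below. Two frames of one oriented plane differ by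
  a matrix of positive determinant, so saturation makes the preimage among the representatives
  exactly \<open>UNIV \<times> W\<close>.\<close>

lemma oplane_open_saturated:
  assumes W: "openin (top_of_set {f. frame f}) W"
    and sat: "\<And>f C. f \<in> W \<Longrightarrow> det C > 0 \<Longrightarrow> (\<lambda>i. comb f (C $ i)) \<in> W"
  shows "oplane_open {oplane p f | p f. f \<in> W}"
proof -
  have WF: "W \<subseteq> {f. frame f}" using W by (rule openin_imp_subset)
  have "{r \<in> UNIV \<times> {f. frame f}. oplane (fst r) (snd r) \<in> {oplane p f | p f. f \<in> W}} = UNIV \<times> W"
    using WF by (force elim: oplane_eqD dest: sat)
  then show ?thesis
    using WF openin_Times[OF openin_subtopology_self W, of UNIV]
    by (auto simp: oplane_open_def oriented_planes_def)
qed

section \<open>Graphs of families of linear maps\<close>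

definition graph_frame :: "real^'k::finite^'q::finite \<Rightarrow> 'k \<Rightarrow> (real^'k) \<times> (real^'q)" where
  "graph_frame M i = (axis i 1, M *v axis i 1)"

definition total_map :: "(real^'q::finite \<Rightarrow> real^'k::finite^'q) \<Rightarrow> (real^'k) \<times> (real^'q) \<Rightarrow> (real^'k) \<times> (real^'q)" where
  "total_map B = (\<lambda>(t, y). (t, y + B y *v t))"

lemma comb_graph_frame: "comb (graph_frame M) c = (c, M *v c)"
proof -
  have "linear (\<lambda>c. (c, M *v c))"
    by (intro linearI) (simp_all add: matrix_vector_right_distrib matrix_vector_mult_scaleR)
  from linear_eq_comb[OF this, of c] show ?thesis
    by (simp add: graph_frame_def[abs_def])
qed

lemma frame_graph_frame: "frame (graph_frame M)"
  by (simp add: frame_iff comb_graph_frame zero_prod_def)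

lemma Pl_eq: "Pl B y = oplane (0, y) (graph_frame (B y))"
  by (simp add: Pl_def graph_frame_def[abs_def])

lemma fst_Pl: "fst (Pl B y) = range (\<lambda>t. total_map B (t, y))"
  by (simp add: Pl_eq fst_oplane comb_graph_frame total_map_def)

text \<open>Over \<open>t = 0\<close> each plane has only its base point, so the point set alone
  determines \<open>y\<close>.\<close>

lemma mem_Pl_zero: "(0, z) \<in> fst (Pl B y) \<longleftrightarrow> z = y"
  by (auto simp: fst_Pl total_map_def)

lemma inj_Pl: "inj (Pl B)"
  by (metis injI mem_Pl_zero)

lemma continuous_on_matrix_vector:
  fixes M :: "'a::topological_space \<Rightarrow> real^'k::finite^'q::finite"
  assumes "continuous_on S M" "continuous_on S v"
  shows "continuous_on S (\<lambda>x. M x *v v x)"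
  unfolding matrix_vector_mult_def by (intro continuous_intros assms)

lemma continuous_on_graph_frame:
  assumes "continuous_on S M"
  shows "continuous_on S (\<lambda>x. graph_frame (M x))"
  unfolding graph_frame_def[abs_def]
  by (intro continuous_on_coordinatewise_then_product continuous_intros continuous_on_matrix_vector assms)

lemma continuous_on_total_map:
  assumes "continuous_on UNIV B"
  shows "continuous_on UNIV (total_map B)"
  unfolding total_map_def case_prod_beta'
  by (intro continuous_intros continuous_on_matrix_vector continuous_on_compose2[OF assms]) auto

section \<open>Skew fibrations satisfy both conditions\<close>

lemma bij_total_map_if_fibration:
  assumes fib: "fibration (range (Pl B))"
  shows "bij (total_map B)"
proof (rule bijI)
  show "inj (total_map B)"
  proof (rule injI, clarify)
    fix s x t y assume eq: "total_map B (s, x) = total_map B (t, y)"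
    then have st: "s = t" by (simp add: total_map_def)
    have "total_map B (s, x) \<in> fst (Pl B x) \<inter> fst (Pl B y)"
      unfolding fst_Pl by (metis IntI eq rangeI)
    then have "Pl B x = Pl B y" using fib unfolding fibration_def by blast
    with st show "s = t \<and> x = y" using inj_Pl by (auto dest: injD)
  qed
  show "surj (total_map B)"
  proof -
    have "w \<in> range (total_map B)" for w
    proof -
      obtain y where "w \<in> fst (Pl B y)" using fib unfolding fibration_def by blast
      then show ?thesis by (auto simp: fst_Pl)
    qed
    then show ?thesis by auto
  qed
qed

text \<open>Invariance of domain: a continuous injection of a Euclidean space into itself is a
  homeomorphism onto its range, here the whole space.\<close>

lemma continuous_on_inv_total_map:
  assumes "continuous_on UNIV B" "bij (total_map B)"
  shows "continuous_on UNIV (inv (total_map B))"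
proof -
  obtain g where "homeomorphism UNIV (range (total_map B)) (total_map B) g"
    using invariance_of_domain_homeomorphism[OF open_UNIV continuous_on_total_map[OF assms(1)]]
      assms(2) by (auto simp: bij_is_inj)
  then have g: "continuous_on UNIV g" "\<And>x. g (total_map B x) = x"
    using assms(2) by (auto simp: homeomorphism_def bij_is_surj)
  have "inv (total_map B) = g"
    by (metis assms(2) bij_is_surj ext g(2) surj_f_inv_f)
  with g show ?thesis by simp
qed

lemma kernel_trivial_if_skew_fibration:
  assumes fib: "fibration (range (Pl B))" and sk: "skew (range (Pl B))" and "x \<noteq> y"
  shows "{v. Amap B x v - Amap B y v = 0} = {0}"
proof -
  have "t = 0 \<and> l = 0" if eq: "Amap B x (t, l) = Amap B y (t, l)" for t l
  proof (cases "l = 0")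
    case True
    have "t = 0"
    proof (rule ccontr)
      assume "t \<noteq> 0"
      then have "(t, B x *v t) \<noteq> 0" by (simp add: zero_prod_def)
      \<comment> \<open>The line through the base point over direction \<open>t\<close> stays in the
        plane; equal values \<open>B x *v t\<close> and \<open>B y *v t\<close> make the two lines
        parallel.\<close>
      moreover have "(0, z) + s *\<^sub>R (t, B z *v t) \<in> fst (Pl B z)" for s z
        unfolding fst_Pl by (rule image_eqI[of _ _ "s *\<^sub>R t"]) (simp_all add: total_map_def matrix_vector_mult_scaleR)
      moreover have "B x *v t = B y *v t" using eq True by (simp add: Amap_def)
      moreover have "Pl B x \<noteq> Pl B y" using \<open>x \<noteq> y\<close> inj_Pl by (auto dest: injD)
      ultimately show False using sk unfolding skew_def by (metis rangeI)
    qed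
    with True show ?thesis by simp
  next
    case False
    \<comment> \<open>Dividing the kernel vector by \<open>l\<close> gives the parameter of a common
      point of the two planes.\<close>
    have "total_map B (inverse l *\<^sub>R t, x) = total_map B (inverse l *\<^sub>R t, y)"
    proof -
      have "inverse l *\<^sub>R (B x *v t + l *\<^sub>R x) = inverse l *\<^sub>R (B y *v t + l *\<^sub>R y)"
        using eq by (simp add: Amap_def)
      then show ?thesis using False
        by (simp add: total_map_def matrix_vector_mult_scaleR scaleR_add_right add.commute)
    qed
    then show ?thesis using bij_total_map_if_fibration[OF fib] \<open>x \<noteq> y\<close> by (auto dest: bij_is_inj injD)
  qed
  then show ?thesis by (auto simp: zero_prod_def Amap_def)
qed

lemma infdist_at_top_if_fibration:
  assumes cont: "continuous_on UNIV B" and fib: "fibration (range (Pl B))"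
    and nacc: "\<not> (\<exists>z r. strict_mono r \<and> (s \<circ> r) \<longlonglongrightarrow> z)"
  shows "filterlim (\<lambda>m. infdist 0 (fst (Pl B (s m)))) at_top sequentially"
  unfolding filterlim_at_top
proof (rule allI, rule ccontr)
  fix Z assume "\<not> (\<forall>\<^sub>F m in sequentially. Z \<le> infdist 0 (fst (Pl B (s m))))"
  \<comment> \<open>Failure of divergence to infinity gives a subsequence of planes all closer to
    the origin than \<open>Z\<close>.\<close>
  then obtain r :: "nat \<Rightarrow> nat" where r: "strict_mono r"
    and "\<And>m. \<not> Z \<le> infdist 0 (fst (Pl B (s (r m))))"
    by (auto dest: not_eventually_sequentiallyD)
  then have near: "infdist 0 (fst (Pl B (s (r m)))) < Z" for m by (simp add: not_le)
  note bij = bij_total_map_if_fibration[OF fib]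
  \<comment> \<open>The base points of all planes meeting the closed ball of radius
    \<open>Z\<close>: a continuous image of a compact set.\<close>
  define K where "K = (\<lambda>w. snd (inv (total_map B) w)) ` cball 0 Z"
  have "compact K"
    unfolding K_def
    by (intro compact_continuous_image continuous_intros compact_cball
        continuous_on_subset[OF continuous_on_inv_total_map[OF cont bij]]) auto
  moreover have "s (r m) \<in> K" for m
  proof -
    \<comment> \<open>The distance is an infimum, so a strict bound on it is already met by some
      point of the plane.\<close>
    have "\<exists>w\<in>fst (Pl B (s (r m))). dist 0 w < Z"
    proof (rule ccontr)
      assume "\<not> ?thesis"
      then have "Z \<le> infdist 0 (fst (Pl B (s (r m))))"
        by (subst infdist_notempty) (auto simp: fst_Pl not_less intro!: cINF_greatest)
      with near[of m] show False by simp
    qed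
    then obtain t where "norm (total_map B (t, s (r m))) < Z" by (auto simp: fst_Pl)
    moreover have "s (r m) = snd (inv (total_map B) (total_map B (t, s (r m))))"
      using bij by (simp add: bij_is_inj)
    ultimately show ?thesis unfolding K_def by (intro image_eqI) auto
  qed
  then have "\<forall>n. (s \<circ> r) n \<in> K" by simp
  ultimately obtain z r' where "strict_mono r'" "((s \<circ> r) \<circ> r') \<longlonglongrightarrow> z"
    unfolding compact_def by blast
  then have "strict_mono (r \<circ> r') \<and> (s \<circ> (r \<circ> r')) \<longlonglongrightarrow> z"
    using r by (simp add: strict_mono_o comp_assoc)
  with nacc show False by blast
qed

section \<open>Both conditions produce a skew fibration\<close>

lemma inj_total_map:
  assumes "\<And>x y. x \<noteq> y \<Longrightarrow> {v. Amap B x v - Amap B y v = 0} = {0}"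
  shows "inj (total_map B)"
proof (rule injI, clarify)
  fix s x t y assume eq: "total_map B (s, x) = total_map B (t, y)"
  then have st: "s = t" by (simp add: total_map_def)
  \<comment> \<open>A common point over \<open>s\<close> is a kernel vector with last coordinate
    \<open>1\<close>.\<close>
  have mem: "(s, 1) \<in> {v. Amap B x v - Amap B y v = 0}"
    using eq st by (simp add: total_map_def Amap_def add.commute)
  have "x = y"
  proof (rule ccontr)
    assume "x \<noteq> y"
    from mem show False unfolding assms[OF \<open>x \<noteq> y\<close>] by (simp add: zero_prod_def)
  qed
  with st show "s = t \<and> x = y" by simp
qed

lemma surj_total_map:
  assumes cont: "continuous_on UNIV B" and inj: "inj (total_map B)"
    and proper: "\<And>s :: nat \<Rightarrow> real^'q. \<not> (\<exists>z r. strict_mono r \<and> (s \<circ> r) \<longlonglongrightarrow> z) \<Longrightarrow>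
                  filterlim (\<lambda>m. infdist 0 (fst (Pl B (s m)))) at_top sequentially"
  shows "surj (total_map (B :: real^'q::finite \<Rightarrow> real^'k::finite^'q))"
proof -
  note contG = continuous_on_total_map[OF cont]
  have "open (range (total_map B))"
    by (intro invariance_of_domain contG open_UNIV inj)
  moreover have "closed (range (total_map B))"
    unfolding closed_sequential_limits
  proof clarify
    fix w :: "nat \<Rightarrow> (real^'k) \<times> (real^'q)" and t z
    assume w: "\<forall>n. w n \<in> range (total_map B)" and lim: "w \<longlonglongrightarrow> (t, z)"
    then have "\<exists>p. w n = total_map B p" for n by blast
    then obtain p where p: "\<And>n. w n = total_map B (p n)" by metis
    \<comment> \<open>The first coordinate is unchanged by \<open>total_map B\<close>, so it
      converges along with \<open>w\<close>; only the base points need a compactness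
      argument.\<close>
    have fstw: "fst (w n) = fst (p n)" for n by (simp add: p total_map_def split: prod.split)
    obtain C where C: "\<And>n. norm (w n) \<le> C"
      using convergent_imp_bounded[OF lim] by (auto simp: bounded_iff)
    \<comment> \<open>The bounded points \<open>w n\<close> keep the planes near the origin.
      Condition (ii), used contrapositively, then yields a convergent subsequence of base
      points.\<close>
    have "infdist 0 (fst (Pl B (snd (p n)))) \<le> C" for n
    proof (rule infdist_le2)
      show "w n \<in> fst (Pl B (snd (p n)))" unfolding fst_Pl p by (metis prod.collapse rangeI)
      show "dist 0 (w n) \<le> C" using C by simp
    qed
    then have "\<not> C < infdist 0 (fst (Pl B ((snd \<circ> p) n)))" for n
      by (simp add: not_less)
    then have "\<not> (\<forall>\<^sub>F m in sequentially. C < infdist 0 (fst (Pl B ((snd \<circ> p) m))))"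
      by simp
    then have "\<not> filterlim (\<lambda>m. infdist 0 (fst (Pl B ((snd \<circ> p) m)))) at_top sequentially"
      unfolding filterlim_at_top_dense by blast
    then obtain y r where r: "strict_mono r" and y: "((snd \<circ> p) \<circ> r) \<longlonglongrightarrow> y"
      using proper by blast
    have limr: "(\<lambda>n. w (r n)) \<longlonglongrightarrow> (t, z)"
      using LIMSEQ_subseq_LIMSEQ[OF lim r] by (simp add: comp_def)
    have "(\<lambda>n. fst (p (r n))) \<longlonglongrightarrow> t"
      using tendsto_fst[OF limr] by (simp add: fstw)
    then have "(\<lambda>n. (fst (p (r n)), snd (p (r n)))) \<longlonglongrightarrow> (t, y)"
      using y by (intro tendsto_Pair) (auto simp: comp_def)
    then have "(\<lambda>n. total_map B (p (r n))) \<longlonglongrightarrow> total_map B (t, y)"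
      using contG by (intro continuous_on_tendsto_compose[OF contG]) auto
    with limr have "(t, z) = total_map B (t, y)"
      by (simp add: p LIMSEQ_unique)
    then show "(t, z) \<in> range (total_map B)" by blast
  qed
  ultimately have "range (total_map B) = {} \<or> range (total_map B) = UNIV"
    using clopen[of "range (total_map B)"] by blast
  then show ?thesis by simp
qed

lemma fibration_if_bij:
  assumes cont: "continuous_on UNIV B" and bij: "bij (total_map B)"
  shows "fibration (range (Pl B))"
proof -
  let ?y = "\<lambda>w. snd (inv (total_map B) w)"
  have mem: "w \<in> fst (Pl B y) \<longleftrightarrow> y = ?y w" for w y
  proof
    assume "w \<in> fst (Pl B y)"
    then show "y = ?y w" using bij by (auto simp: fst_Pl bij_is_inj)
  next
    assume "y = ?y w"
    then show "w \<in> fst (Pl B y)"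
      unfolding fst_Pl using bij by (intro image_eqI[of _ _ "fst (inv (total_map B) w)"])
       (simp_all add: bij_is_surj surj_f_inv_f)
  qed
  have the: "(THE P. P \<in> range (Pl B) \<and> w \<in> fst P) = Pl B (?y w)" for w
    by (rule the_equality) (auto simp: mem)
  have "open ((\<lambda>w. THE P. P \<in> range (Pl B) \<and> w \<in> fst P) -` U)" if U: "oplane_open U" for U
  proof -
    \<comment> \<open>A continuous choice of representatives: the fiber map factors through
      \<open>?g\<close>, so preimages of open sets of planes are preimages under
      \<open>?g\<close>.\<close>
    let ?g = "\<lambda>w. ((0, ?y w) :: (real^'b) \<times> (real^'a), graph_frame (B (?y w)))"
    obtain O' where O': "open O'"
      "{r \<in> UNIV \<times> {f. frame f}. oplane (fst r) (snd r) \<in> U} = UNIV \<times> {f. frame f} \<inter> O'"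
      using U unfolding oplane_open_def openin_open by auto
    have "oplane (0, ?y w) (graph_frame (B (?y w))) \<in> U \<longleftrightarrow> ?g w \<in> O'" for w
    proof -
      \<comment> \<open>Openness in the quotient topology is relative to genuine frames, and graph
        frames always are genuine.\<close>
      have "?g w \<in> UNIV \<times> {f. frame f}" by (simp add: frame_graph_frame)
      then show ?thesis using O'(2) by (auto simp: set_eq_iff)
    qed
    then have "(\<lambda>w. THE P. P \<in> range (Pl B) \<and> w \<in> fst P) -` U = ?g -` O'"
      by (simp only: the Pl_eq vimage_def)
    moreover have conty: "continuous_on UNIV ?y"
      by (intro continuous_on_snd continuous_on_inv_total_map cont bij)
    then have "continuous_on UNIV ?g"
      by (intro continuous_on_Pair continuous_on_const continuous_on_graph_frame
          continuous_on_compose2[OF cont conty] subset_UNIV)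
    ultimately show ?thesis using O'(1) by (simp add: open_vimage)
  qed
  moreover have "range (Pl B) \<subseteq> oriented_planes"
    using frame_graph_frame by (auto simp: oriented_planes_def Pl_eq)
  ultimately show ?thesis
    unfolding fibration_def using mem by auto
qed

lemma skew_if_kernel_trivial:
  assumes ker: "\<And>x y. x \<noteq> y \<Longrightarrow> {v. Amap B x v - Amap B y v = 0} = {0}"
  shows "skew (range (Pl B))"
  unfolding skew_def
proof (intro ballI impI notI)
  fix P Q assume "P \<in> range (Pl B)" "Q \<in> range (Pl B)" and ne: "P \<noteq> Q"
    and par: "\<exists>a b v. v \<noteq> 0 \<and> (\<forall>t. a + t *\<^sub>R v \<in> fst P) \<and> (\<forall>t. b + t *\<^sub>R v \<in> fst Q)"
  then obtain x y where PQ: "P = Pl B x" "Q = Pl B y" by auto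
  from par obtain a1 a2 b1 b2 v1 v2 where v: "(v1, v2) \<noteq> 0"
    and a: "\<forall>t. (a1, a2) + t *\<^sub>R (v1, v2) \<in> fst (Pl B x)"
    and b: "\<forall>t. (b1, b2) + t *\<^sub>R (v1, v2) \<in> fst (Pl B y)"
    unfolding PQ by (metis prod.collapse)
  \<comment> \<open>Comparing the points of the line at parameters \<open>0\<close> and
    \<open>1\<close> shows that its direction lies on the graph of \<open>B z\<close>.\<close>
  have dir: "v2 = B z *v v1" if "\<forall>t. (c1, c2) + t *\<^sub>R (v1, v2) \<in> fst (Pl B z)" for c1 c2 z
  proof -
    have "c2 = z + B z *v c1" using that[rule_format, of 0] by (auto simp: fst_Pl total_map_def)
    moreover have "c2 + v2 = z + B z *v (c1 + v1)"
      using that[rule_format, of 1] by (auto simp: fst_Pl total_map_def)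
    ultimately show ?thesis by (simp add: matrix_vector_right_distrib)
  qed
  have xy: "x \<noteq> y" using ne PQ by auto
  \<comment> \<open>A common direction is a kernel vector with last coordinate
    \<open>0\<close>.\<close>
  have "(v1, 0) \<in> {v. Amap B x v - Amap B y v = 0}"
    using dir[OF a] dir[OF b] by (simp add: Amap_def)
  then have "(v1, 0 :: real) \<in> {0}" unfolding ker[OF xy] .
  then have "v1 = 0" by (simp add: zero_prod_def)
  with dir[OF a] v show False by (simp add: zero_prod_def)
qed

lemma skew_fibration_iff:
  fixes B :: "real^'q::finite \<Rightarrow> real^'k::finite^'q"
  assumes "continuous_on UNIV B"
  shows "(fibration (range (Pl B)) \<and> skew (range (Pl B))) \<longleftrightarrow>
             ((\<forall>x y. x \<noteq> y \<longrightarrow> {v. Amap B x v - Amap B y v = 0} = {0}) \<and>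
              (\<forall>s :: nat \<Rightarrow> real^'q.
                  \<not> (\<exists>z r. strict_mono r \<and> (s \<circ> r) \<longlonglongrightarrow> z) \<longrightarrow>
                  filterlim (\<lambda>m. infdist 0 (fst (Pl B (s m)))) at_top sequentially))"
    (is "?L \<longleftrightarrow> ?K \<and> ?D")
proof
  assume ?L
  then show "?K \<and> ?D"
    using kernel_trivial_if_skew_fibration infdist_at_top_if_fibration[OF assms] by blast
next
  assume R: "?K \<and> ?D"
  then have inj: "inj (total_map B)" by (intro inj_total_map) blast
  moreover have "surj (total_map B)" using R by (intro surj_total_map assms inj) blast
  ultimately have "fibration (range (Pl B))" by (intro fibration_if_bij assms bijI)
  moreover have "skew (range (Pl B))" using R by (intro skew_if_kernel_trivial) blast
  ultimately show ?L by blast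
qed

section \<open>Fibrations transverse to an affine subspace\<close>

definition horiz :: "('k::finite \<Rightarrow> (real^'k) \<times> (real^'q::finite)) \<Rightarrow> real^'k^'k" where
  "horiz g = (\<chi> j i. fst (g i) $ j)"

definition vert :: "('k::finite \<Rightarrow> (real^'k) \<times> (real^'q::finite)) \<Rightarrow> real^'k^'q" where
  "vert g = (\<chi> j i. snd (g i) $ j)"

text \<open>When \<open>horiz g\<close> is invertible, the span of \<open>g\<close> is a graph over
  the first factor, and this is the matrix of that graph.\<close>

definition slope :: "('k::finite \<Rightarrow> (real^'k) \<times> (real^'q::finite)) \<Rightarrow> real^'k^'q" where
  "slope g = vert g ** matrix_inv (horiz g)"

text \<open>The transpose arises because vectors are columns of \<open>horiz\<close> while their
  coordinates are rows of \<open>C\<close>.\<close>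

lemma horiz_comb: "horiz (\<lambda>i. comb g (C $ i)) = horiz g ** transpose C"
  by (simp add: horiz_def comb_def vec_eq_iff matrix_matrix_mult_def transpose_def fst_sum mult.commute)

lemma vert_comb: "vert (\<lambda>i. comb g (C $ i)) = vert g ** transpose C"
  by (simp add: vert_def comb_def vec_eq_iff matrix_matrix_mult_def transpose_def snd_sum mult.commute)

lemma horiz_mult: "horiz g *v c = fst (comb g c)"
  by (simp add: horiz_def comb_def vec_eq_iff matrix_vector_mult_def fst_sum mult.commute)

lemma slope_horiz: "det (horiz g) \<noteq> 0 \<Longrightarrow> slope g ** horiz g = vert g"
  by (simp add: slope_def matrix_mul_assoc[symmetric] matrix_inv_left invertible_det_nz)

lemma slope_unique:
  assumes "det (horiz g) \<noteq> 0" "S ** horiz g = vert g"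
  shows "slope g = S"
  using assms(1)
  by (simp add: slope_def assms(2)[symmetric] matrix_mul_assoc[symmetric] matrix_inv_right invertible_det_nz)

text \<open>A change of frame multiplies \<open>horiz\<close> and \<open>vert\<close> on the right
  by the same invertible matrix, which cancels: the slope belongs to the span.\<close>

lemma slope_comb:
  assumes "det (horiz g) \<noteq> 0" "det C \<noteq> 0"
  shows "slope (\<lambda>i. comb g (C $ i)) = slope g"
  using assms
  by (intro slope_unique) (simp_all add: horiz_comb vert_comb det_mul matrix_mul_assoc slope_horiz)

text \<open>A vector on a graph has its own first component as coordinates in the graph frame. Hence
  the sign of \<open>det (horiz g)\<close> compares the orientation of \<open>g\<close> with that of
  the first factor.\<close>

lemma comb_graph_frame_slope:
  assumes "det (horiz g) \<noteq> 0"
  shows "comb (graph_frame (slope g)) (transpose (horiz g) $ i) = g i"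
proof -
  have fst_g: "transpose (horiz g) $ i = fst (g i)"
    by (simp add: horiz_def transpose_def vec_eq_iff)
  have "(slope g *v fst (g i)) $ j = (slope g ** horiz g) $ j $ i" for j
    by (simp add: matrix_vector_mult_def matrix_matrix_mult_def horiz_def)
  then have "slope g *v fst (g i) = snd (g i)"
    by (simp add: slope_horiz[OF assms] vec_eq_iff vert_def)
  then show ?thesis by (simp add: comb_graph_frame fst_g)
qed

text \<open>Cramer's rule writes each entry as a quotient of determinants; in the numerator, column
  \<open>i\<close> of \<open>A\<close> is replaced by the basis vector
  \<open>axis j 1\<close>.\<close>

lemma continuous_on_matrix_inv: "continuous_on {A :: real^'n::finite^'n. det A \<noteq> 0} matrix_inv"
proof -
  have entry: "matrix_inv A $ i $ j = det (\<chi> i' j'. if j' = i then axis j 1 $ i' else A $ i' $ j') / det A"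
    if "det A \<noteq> 0" for A :: "real^'n^'n" and i j
  proof -
    have "A *v (matrix_inv A *v axis j 1) = axis j 1"
      using that by (simp add: matrix_vector_mul_assoc matrix_inv_right invertible_det_nz)
    then have "(matrix_inv A *v axis j 1) $ i = det (\<chi> i' j'. if j' = i then axis j 1 $ i' else A $ i' $ j') / det A"
      unfolding cramer[OF that] by simp
    then show ?thesis by (simp add: matrix_vector_mult_basis column_def)
  qed
  have "continuous_on {A :: real^'n^'n. det A \<noteq> 0} (\<lambda>A. matrix_inv A $ i $ j)" for i j
  proof (rule continuous_on_eq)
    show "continuous_on {A :: real^'n^'n. det A \<noteq> 0}
       (\<lambda>A. det (\<chi> i' j'. if j' = i then axis j 1 $ i' else A $ i' $ j') / det A)"
    proof (intro continuous_on_divide continuous_on_det)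
      have "continuous_on {A :: real^'n^'n. det A \<noteq> 0} (\<lambda>A. if j' = i then axis j 1 $ i' else A $ i' $ j')" for i' j'
        by (cases "j' = i") (auto intro!: continuous_intros)
      then show "continuous_on {A :: real^'n^'n. det A \<noteq> 0}
          (\<lambda>A. \<chi> i' j'. if j' = i then axis j 1 $ i' else A $ i' $ j')"
        by (intro continuous_on_vec_lambda)
    qed (auto intro: continuous_on_id)
  qed (simp add: entry)
  then have "continuous_on {A :: real^'n^'n. det A \<noteq> 0} (\<lambda>A. \<chi> i j. matrix_inv A $ i $ j)"
    by (intro continuous_on_vec_lambda)
  then show ?thesis by simp
qed

lemma continuous_on_linear_coord:
  fixes K :: "'a::euclidean_space \<Rightarrow> 'b::real_normed_vector"
  assumes "linear K"
  shows "continuous_on S (\<lambda>f :: 'k \<Rightarrow> 'a. K (f i))"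
proof (rule continuous_on_compose2[of UNIV K])
  show "continuous_on UNIV K" by (simp add: assms linear_continuous_on linear_conv_bounded_linear[symmetric])
  show "continuous_on S (\<lambda>f :: 'k \<Rightarrow> 'a. f i)"
    by (rule continuous_on_product_then_coordinatewise) (rule continuous_on_id)
qed simp

lemma continuous_on_horiz: "linear K \<Longrightarrow> continuous_on S (\<lambda>f. horiz (K \<circ> f))"
  and continuous_on_vert: "linear K \<Longrightarrow> continuous_on S (\<lambda>f. vert (K \<circ> f))"
  for K :: "'a::euclidean_space \<Rightarrow> (real^'k::finite) \<times> (real^'q::finite)"
  unfolding horiz_def vert_def comp_def
  by (intro continuous_on_vec_lambda continuous_on_component continuous_on_fst continuous_on_snd
      continuous_on_linear_coord; assumption)+

lemma continuous_on_slope: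
  fixes K :: "'a::euclidean_space \<Rightarrow> (real^'k::finite) \<times> (real^'q::finite)"
  assumes "linear K"
  shows "continuous_on {f. det (horiz (K \<circ> f)) \<noteq> 0} (\<lambda>f. slope (K \<circ> f))"
proof -
  have "continuous_on {f. det (horiz (K \<circ> f)) \<noteq> 0} (\<lambda>f. matrix_inv (horiz (K \<circ> f)))"
    by (rule continuous_on_compose2[OF continuous_on_matrix_inv continuous_on_horiz[OF assms]]) auto
  then show ?thesis
    unfolding slope_def matrix_matrix_mult_def
    by (intro continuous_on_vec_lambda continuous_on_sum continuous_on_mult continuous_on_component
        continuous_on_vert[OF assms])
qed

lemma comp_comb: "linear K \<Longrightarrow> K \<circ> (\<lambda>i. comb f (C $ i)) = (\<lambda>i. comb (K \<circ> f) (C $ i))"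
  by (simp add: fun_eq_iff linear_comb_image)

text \<open>A saturated set of frames cannot separate two frames of one oriented plane, so any
  representative decides membership.\<close>

lemma oplane_mem_saturated_iff:
  assumes "W \<subseteq> {f. frame f}"
    and "\<And>f C. f \<in> W \<Longrightarrow> det C > 0 \<Longrightarrow> (\<lambda>i. comb f (C $ i)) \<in> W"
    and "frame f"
  shows "oplane p f \<in> {oplane p f | p f. f \<in> W} \<longleftrightarrow> f \<in> W"
proof
  assume "oplane p f \<in> {oplane p f | p f. f \<in> W}"
  then obtain p' f' where f': "oplane p f = oplane p' f'" "f' \<in> W" by blast
  moreover have "frame f'" using f'(2) assms(1) by blast
  ultimately obtain C where "det C > 0" "f = (\<lambda>i. comb f' (C $ i))"
    using oplane_eqD[OF assms(3)] by metis
  with f'(2) assms(2) show "f \<in> W" by blast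
qed blast

section \<open>The fiber map and the sign of the orientation\<close>

definition fiber :: "('a::euclidean_space set \<times> ('k::finite \<Rightarrow> 'a) set) set \<Rightarrow> 'a \<Rightarrow> 'a set \<times> ('k \<Rightarrow> 'a) set" where
  "fiber F x = (THE P. P \<in> F \<and> x \<in> fst P)"

lemma fiber_eq: "fibration F \<Longrightarrow> P \<in> F \<Longrightarrow> x \<in> fst P \<Longrightarrow> fiber F x = P"
  unfolding fiber_def fibration_def by (rule the_equality) blast+

lemma fiber_mem: assumes "fibration F" shows "fiber F x \<in> F" and "x \<in> fst (fiber F x)"
proof -
  obtain P where "P \<in> F" "x \<in> fst P" using assms unfolding fibration_def by blast
  with fiber_eq[OF assms this] show "fiber F x \<in> F" "x \<in> fst (fiber F x)" by auto
qed

lemma open_fiber_vimage: "fibration F \<Longrightarrow> oplane_open U \<Longrightarrow> open (fiber F -` U)"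
  unfolding fibration_def fiber_def[abs_def] by blast

lemma fibration_oplaneE:
  assumes "fibration F" "P \<in> F"
  obtains p f where "frame f" "P = oplane p f"
  using assms unfolding fibration_def oriented_planes_def by blast

text \<open>For \<open>s = 1\<close> or \<open>s = -1\<close>: the frames whose span is, in the coordinates \<open>K\<close>, the graph of a
  matrix in \<open>V\<close>, with orientation of sign \<open>s\<close> relative to the first factor.\<close>
definition signed_frames :: "('a \<Rightarrow> (real^'k) \<times> (real^'q)) \<Rightarrow> real \<Rightarrow> (real^'k^'q) set
    \<Rightarrow> ('k::finite \<Rightarrow> 'a::euclidean_space) set" where
  "signed_frames K s V = {f. frame f \<and> s * det (horiz (K \<circ> f)) > 0 \<and> slope (K \<circ> f) \<in> V}"

lemma signed_frames_comb:
  fixes K :: "'a::euclidean_space \<Rightarrow> (real^'k::finite) \<times> (real^'q::finite)"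
  assumes "linear K" "f \<in> signed_frames K s V" "det C > 0"
  shows "(\<lambda>i. comb f (C $ i)) \<in> signed_frames K s V"
proof -
  have "s * det (horiz (K \<circ> f)) > 0" using assms(2) by (simp add: signed_frames_def)
  from mult_pos_pos[OF this assms(3)] have "s * det (horiz (\<lambda>i. comb (K \<circ> f) (C $ i))) > 0"
    by (simp add: horiz_comb det_mul mult.assoc)
  moreover have "det (horiz (K \<circ> f)) \<noteq> 0" using assms(2) by (auto simp: signed_frames_def)
  ultimately show ?thesis
    using assms by (simp add: signed_frames_def comp_comb slope_comb frame_comb)
qed

text \<open>The sign condition is open, and where it holds with nonzero determinant the slope is
  continuous.\<close>

lemma openin_signed_frames:
  fixes K :: "'a::euclidean_space \<Rightarrow> (real^'k::finite) \<times> (real^'q::finite)"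
  assumes "linear K" "open V"
  shows "openin (top_of_set {f. frame f}) (signed_frames K s V)"
proof -
  let ?D = "{f. s * det (horiz (K \<circ> f)) > 0}"
  have "open ?D"
    by (intro open_Collect_less continuous_intros continuous_on_det continuous_on_horiz assms)
  moreover have "continuous_on ?D (\<lambda>f. slope (K \<circ> f))"
    by (rule continuous_on_subset[OF continuous_on_slope[OF assms(1)]]) auto
  ultimately have "open (?D \<inter> (\<lambda>f. slope (K \<circ> f)) -` V)"
    using assms(2) by (intro continuous_open_preimage)
  moreover have "signed_frames K s V = {f. frame f} \<inter> (?D \<inter> (\<lambda>f. slope (K \<circ> f)) -` V)"
    by (auto simp: signed_frames_def)
  ultimately show ?thesis unfolding openin_open by blast
qed

text \<open>With \<open>V = UNIV\<close> this gives local constancy of the sign; with general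
  \<open>V\<close> it gives continuity of the slope.\<close>

lemma open_fiber_signed:
  fixes K :: "'a::euclidean_space \<Rightarrow> (real^'k::finite) \<times> (real^'q::finite)"
  assumes "fibration F" "linear K" "open V"
  shows "open {x. fiber F x \<in> {oplane p f | p f. f \<in> signed_frames K s V}}"
  using open_fiber_vimage[OF assms(1) oplane_open_saturated[OF openin_signed_frames[OF assms(2,3)]
      signed_frames_comb[OF assms(2)]]]
  by (simp add: vimage_def)

lemma oplane_mem_signed_iff:
  fixes K :: "'a::euclidean_space \<Rightarrow> (real^'k::finite) \<times> (real^'q::finite)"
  assumes "linear K" "frame f"
  shows "oplane p f \<in> {oplane p f | p f. f \<in> signed_frames K s V} \<longleftrightarrow> f \<in> signed_frames K s V"
  by (rule oplane_mem_saturated_iff[OF _ signed_frames_comb[OF assms(1)] assms(2)])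
    (auto simp: signed_frames_def)

text \<open>The points with fibers of positive and of negative sign form two disjoint open sets
  covering a connected space, so one of them is empty.\<close>

lemma fibration_constant_sign:
  fixes K :: "'a::euclidean_space \<Rightarrow> (real^'k::finite) \<times> (real^'q::finite)"
  assumes F: "fibration F" and K: "linear K"
    and nz: "\<And>p f. frame f \<Longrightarrow> oplane p f \<in> F \<Longrightarrow> det (horiz (K \<circ> f)) \<noteq> 0"
  obtains s where "s = 1 \<or> s = -1"
    and "\<And>p f. frame f \<Longrightarrow> oplane p f \<in> F \<Longrightarrow> s * det (horiz (K \<circ> f)) > 0"
proof -
  define X where "X s = {x. fiber F x \<in> {oplane p f | p f. f \<in> signed_frames K s UNIV}}" for s
  have op: "open (X s)" for s
    unfolding X_def by (rule open_fiber_signed[OF F K open_UNIV])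
  have X: "x \<in> X s \<longleftrightarrow> s * det (horiz (K \<circ> f)) > 0" if "fiber F x = oplane p f" "frame f" for x s p f
    unfolding X_def mem_Collect_eq[of x] that(1) oplane_mem_signed_iff[OF K that(2)]
    using that(2) by (simp add: signed_frames_def)
  have rep: "\<exists>p f. fiber F x = oplane p f \<and> frame f \<and> det (horiz (K \<circ> f)) \<noteq> 0" for x
    using fibration_oplaneE[OF F fiber_mem(1)[OF F]] nz fiber_mem(1)[OF F] by metis
  have cover: "x \<in> X 1 \<or> x \<in> X (-1)" and disj: "\<not> (x \<in> X 1 \<and> x \<in> X (-1))" for x
    using rep[of x] X[of x] by (auto simp: neq_iff)
  have "X 1 = {} \<or> X (-1) = {}"
    using connectedD[OF connected_UNIV op op, of 1 "-1"] cover disj by auto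
  then obtain s where s: "s = 1 \<or> s = -1" "\<And>x. x \<in> X s" using cover by (metis empty_iff)
  have "s * det (horiz (K \<circ> f)) > 0" if "frame f" "oplane p f \<in> F" for p f
  proof -
    \<comment> \<open>Each plane is the fiber through its own base point, so a sign known at all
      points is known for all planes.\<close>
    have "p + comb f 0 \<in> fst (oplane p f)" unfolding fst_oplane by (rule rangeI)
    then have "fiber F (p + comb f 0) = oplane p f" by (rule fiber_eq[OF F that(2)])
    with X that(1) s(2) show ?thesis by blast
  qed
  with s(1) that show ?thesis by blast
qed

section \<open>Oriented planes in isometric coordinates\<close>

lemma comb_linear_comp: "linear L \<Longrightarrow> comb (L \<circ> f) = L \<circ> comb f"
  by (simp add: fun_eq_iff linear_comb_image)

text \<open>\<open>L\<close> preserves inner products, hence the Gram determinants that define the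
  orientation; subtracting the image of \<open>0\<close> leaves the linear part acting on
  frames.\<close>

lemma transport_oplane:
  fixes L :: "'a::euclidean_space \<Rightarrow> 'a"
  assumes L: "orthogonal_transformation L"
  shows "transport (\<lambda>u. a + L u) (oplane p f) = oplane (a + L p) (L \<circ> f)"
proof -
  have lin: "linear L" and inj: "inj L" and surj: "surj L"
    using L by (simp_all add: orthogonal_transformation_linear orthogonal_transformation_inj orthogonal_transformation_surj)
  have ip: "L u \<bullet> L v = u \<bullet> v" for u v using L by (simp add: orthogonal_transformation_def)
  have fr: "frame (L \<circ> g) \<longleftrightarrow> frame g" for g :: "'k::finite \<Rightarrow> 'a"
    using inj lin by (simp add: frame_iff comb_linear_comp linear_injective_0) (metis linear_0)
  have sp: "span (range (L \<circ> g)) = L ` span (range g)" for g :: "'k::finite \<Rightarrow> 'a"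
    by (simp only: span_range_eq comb_linear_comp[OF lin] image_comp)
  have "(\<lambda>u. a + L u) ` fst (oplane p f) = fst (oplane (a + L p) (L \<circ> f))"
    by (simp only: fst_oplane image_image comb_linear_comp[OF lin] linear_add[OF lin] add.assoc comp_apply)
  moreover have "(\<lambda>g i. (a + L (g i)) - (a + L 0)) ` snd (oplane p f) = snd (oplane (a + L p) (L \<circ> f))"
  proof -
    have "(\<lambda>g. L \<circ> g) ` snd (oplane p f) = snd (oplane (a + L p) (L \<circ> f))"
    proof (intro equalityI subsetI)
      fix g assume "g \<in> (\<lambda>g. L \<circ> g) ` snd (oplane p f)"
      then show "g \<in> snd (oplane (a + L p) (L \<circ> f))"
        by (auto simp: oplane_def fr sp[unfolded comp_def] ip)
    next
      fix g assume g: "g \<in> snd (oplane (a + L p) (L \<circ> f))"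
      have gL: "g = L \<circ> (inv L \<circ> g)" using surj by (simp add: fun_eq_iff surj_f_inv_f)
      have "frame (L \<circ> (inv L \<circ> g)) \<and> span (range (L \<circ> (inv L \<circ> g))) = span (range (L \<circ> f)) \<and>
          det (\<chi> i j. (L \<circ> (inv L \<circ> g)) i \<bullet> (L \<circ> f) j) > 0"
        unfolding gL[symmetric] using g by (simp add: oplane_def)
      then have "inv L \<circ> g \<in> snd (oplane p f)"
        unfolding sp inj_image_eq_iff[OF inj] fr comp_apply ip by (simp add: oplane_def)
      with gL show "g \<in> (\<lambda>g. L \<circ> g) ` snd (oplane p f)" by blast
    qed
    then show ?thesis by (simp add: linear_0[OF lin] comp_def)
  qed
  ultimately show ?thesis by (simp add: transport_def prod_eq_iff)
qed

lemma oplane_base_point: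
  assumes "x \<in> fst (oplane p f)"
  shows "oplane x f = oplane p f"
proof -
  obtain c where "x = p + comb f c" using assms by (auto simp: fst_oplane)
  \<comment> \<open>The identity matrix serves as change of frame, so only the base point
    moves.\<close>
  moreover have "comb f (mat 1 $ i) = f i" for i
  proof -
    have "mat 1 $ i = (axis i 1 :: real^'b)" by (simp add: mat_def axis_def vec_eq_iff)
    then show ?thesis by simp
  qed
  ultimately show ?thesis using oplane_eqI[of "mat 1" p f c] by simp
qed

text \<open>In the coordinates \<open>inv L\<close> the frame arises from the graph frame of its
  slope by the matrix \<open>transpose (horiz (inv L \<circ> f))\<close> of positive determinant, so
  both span the same oriented plane.\<close>

lemma oplane_eq_transport_Pl:
  fixes f :: "'k::finite \<Rightarrow> (real^'k) \<times> (real^'q::finite)"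
  assumes L: "orthogonal_transformation L" and det: "det (horiz (inv L \<circ> f)) > 0"
    and y: "a + L (0, y) \<in> fst (oplane p f)" and B: "B y = slope (inv L \<circ> f)"
  shows "oplane p f = transport (\<lambda>u. a + L u) (Pl B y)"
proof -
  let ?g = "inv L \<circ> f" and ?e = "L \<circ> graph_frame (slope (inv L \<circ> f))"
  have lin: "linear L" and surj: "surj L"
    using L by (simp_all add: orthogonal_transformation_linear orthogonal_transformation_surj)
  have "f i = comb ?e (transpose (horiz ?g) $ i)" for i
  proof -
    have "comb ?e (transpose (horiz ?g) $ i) = L (?g i)"
      using det by (simp add: linear_comb_image[OF lin, symmetric] comb_graph_frame_slope del: comp_apply)
    then show ?thesis using surj by (simp add: surj_f_inv_f)
  qed
  then have f: "f = (\<lambda>i. comb ?e (transpose (horiz ?g) $ i))" by blast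
  have "oplane (a + L (0, y)) f = oplane (a + L (0, y)) ?e"
    using oplane_eqI[of "transpose (horiz ?g)" "a + L (0, y)" ?e 0] det f
    by (simp add: linear_0[OF linear_comb])
  then show ?thesis
    by (simp add: transport_oplane[OF L] Pl_eq B oplane_base_point[OF y, symmetric])
qed

lemma oplane_meets_vertical:
  fixes f :: "'k::finite \<Rightarrow> (real^'k) \<times> (real^'q::finite)"
    and L :: "(real^'k) \<times> (real^'q) \<Rightarrow> (real^'k) \<times> (real^'q)"
  assumes L: "orthogonal_transformation L" and det: "det (horiz (inv L \<circ> f)) \<noteq> 0"
  obtains y where "a + L (0, y) \<in> fst (oplane p f)"
proof -
  let ?g = "inv L \<circ> f"
  have lin: "linear L" and surj: "surj L"
    using L by (simp_all add: orthogonal_transformation_linear orthogonal_transformation_surj)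
  have Lg: "L \<circ> ?g = f" using surj by (simp add: fun_eq_iff surj_f_inv_f)
  obtain t z where tz: "L (t, z) = p - a" using surj by (metis surjD prod.collapse)
  \<comment> \<open>Chosen to cancel the first component \<open>t\<close> of the base point in the
    new coordinates.\<close>
  define c where "c = matrix_inv (horiz ?g) *v (- t)"
  have "horiz ?g *v c = - t"
    using det unfolding c_def by (simp add: matrix_vector_mul_assoc matrix_inv_right invertible_det_nz del: mult_minus_right)
  then have "(t, z) + comb ?g c = (0, z + snd (comb ?g c))"
    by (simp add: horiz_mult prod_eq_iff)
  then have "a + L (0, z + snd (comb ?g c)) = a + (L (t, z) + L (comb ?g c))"
    by (metis linear_add[OF lin])
  also have "\<dots> = p + comb f c"
    by (simp add: tz linear_comb_image[OF lin] Lg)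
  finally show ?thesis using that by (metis fst_oplane rangeI)
qed

lemma fibration_as_graphs:
  fixes F :: "(((real^'k::finite) \<times> (real^'q::finite)) set \<times> ('k \<Rightarrow> (real^'k) \<times> (real^'q)) set) set"
  assumes F: "fibration F" and L: "orthogonal_transformation L"
    and pos: "\<And>p f. frame f \<Longrightarrow> oplane p f \<in> F \<Longrightarrow> det (horiz (inv L \<circ> f)) > 0"
  obtains B :: "real^'q \<Rightarrow> real^'k^'q"
  where "continuous_on UNIV B" "F = transport (\<lambda>u. a + L u) ` range (Pl B)"
proof -
  let ?K = "inv L" and ?h = "\<lambda>u. a + L u"
  have K: "linear ?K" and linL: "linear L"
    using L by (auto intro: orthogonal_transformation_linear orthogonal_transformation_inv)
  have "\<forall>y. \<exists>p f. frame f \<and> fiber F (?h (0, y)) = oplane p f"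
    using fibration_oplaneE[OF F fiber_mem(1)[OF F]] by metis
  then obtain p f where fr: "\<And>y. frame (f y)" and pf: "\<And>y. fiber F (?h (0, y)) = oplane (p y) (f y)"
    by metis
  have mem: "oplane (p y) (f y) \<in> F" "?h (0, y) \<in> fst (oplane (p y) (f y))" for y
    unfolding pf[symmetric] using fiber_mem[OF F] by blast+
  \<comment> \<open>The slope of the fiber through the point of the vertical subspace with parameter
    \<open>y\<close>.\<close>
  define B where "B y = slope (?K \<circ> f y)" for y
  have plane: "oplane (p y) (f y) = transport ?h (Pl B y)" for y
    by (rule oplane_eq_transport_Pl[OF L pos[OF fr mem(1)] mem(2) B_def])
  have "continuous_on UNIV B"
    unfolding continuous_on_open_vimage[OF open_UNIV]
  proof (intro allI impI)
    fix V :: "(real^'k^'q) set" assume V: "open V"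
    \<comment> \<open>Positivity holds for every fiber, so membership among the signed planes tests
      only the slope.\<close>
    have "B y \<in> V \<longleftrightarrow> fiber F (?h (0, y)) \<in> {oplane p f | p f. f \<in> signed_frames ?K 1 V}" for y
      unfolding pf oplane_mem_signed_iff[OF K fr]
      using fr pos[OF fr mem(1)] by (simp add: signed_frames_def B_def)
    then have "B -` V = (\<lambda>y. ?h (0, y)) -` {x. fiber F x \<in> {oplane p f | p f. f \<in> signed_frames ?K 1 V}}"
      by blast
    moreover have "continuous_on UNIV (\<lambda>y. ?h (0, y))"
      by (intro continuous_intros linear_continuous_on_compose[OF _ linL])
    ultimately show "open (B -` V \<inter> UNIV)"
      using open_vimage[OF open_fiber_signed[OF F K V, of 1]] by simp
  qed
  moreover have "F = transport ?h ` range (Pl B)"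
  proof (intro equalityI subsetI)
    fix P assume P: "P \<in> F"
    then obtain p' f' where f': "frame f'" "P = oplane p' f'" using fibration_oplaneE[OF F] by blast
    then have "det (horiz (?K \<circ> f')) \<noteq> 0" using pos[of f' p'] P by simp
    \<comment> \<open>Each plane of \<open>F\<close> meets the image of the vertical subspace, hence
      is one of the fibers defining \<open>B\<close>.\<close>
    then obtain y where "?h (0, y) \<in> fst P"
      unfolding f'(2) by (rule oplane_meets_vertical[OF L])
    then have "fiber F (?h (0, y)) = P" by (rule fiber_eq[OF F P])
    then have "P = transport ?h (Pl B y)" by (simp only: pf plane)
    then show "P \<in> transport ?h ` range (Pl B)" by blast
  next
    fix P assume "P \<in> transport ?h ` range (Pl B)"
    then show "P \<in> F" using plane mem(1) by auto
  qed
  ultimately show ?thesis using that by blast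
qed

section \<open>Coordinates adapted to the transverse plane\<close>

lemma vertical_isometry:
  fixes S :: "((real^'k::finite) \<times> (real^'q::finite)) set"
  assumes S: "subspace S" and dim: "dim S = CARD('q)"
  obtains L :: "(real^'k) \<times> (real^'q) \<Rightarrow> (real^'k) \<times> (real^'q)"
  where "orthogonal_transformation L" "L ` ({0} \<times> UNIV) = S"
proof -
  define S' where "S' = {y. \<forall>x\<in>S. orthogonal x y}"
  have S': "subspace S'"
    unfolding S'_def subspace_def by (auto simp: orthogonal_def inner_right_distrib)
  have "dim S' + dim S = dim (UNIV :: ((real^'k) \<times> (real^'q)) set)"
    using dim_subspace_orthogonal_to_vectors[OF S subspace_UNIV] by (simp add: S'_def)
  then have dim': "dim S' = CARD('k)" using dim by simp
  obtain f1 :: "real^'q \<Rightarrow> (real^'k) \<times> (real^'q)"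
    where f1: "linear f1" "f1 \<in> UNIV \<rightarrow> S" "\<And>x. norm (f1 x) = norm x"
    using isometry_subset_subspace[OF subspace_UNIV[where 'a = "real^'q"] S] dim by auto
  obtain f2 :: "real^'k \<Rightarrow> (real^'k) \<times> (real^'q)"
    where f2: "linear f2" "f2 \<in> UNIV \<rightarrow> S'" "\<And>x. norm (f2 x) = norm x"
    using isometry_subset_subspace[OF subspace_UNIV[where 'a = "real^'k"] S'] dim' by auto
  \<comment> \<open>Isometric embeddings into \<open>S\<close> and into its orthogonal complement
    are glued; Pythagoras makes the sum preserve norms.\<close>
  define L where "L u = f2 (fst u) + f1 (snd u)" for u
  have "linear L"
    unfolding L_def
    by (intro linearI) (simp_all add: linear_add[OF f1(1)] linear_add[OF f2(1)]
        linear_scale[OF f1(1)] linear_scale[OF f2(1)] scaleR_add_right)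
  moreover have "norm (L u) = norm u" for u
  proof -
    have "orthogonal (f2 (fst u)) (f1 (snd u))"
      using f1(2) f2(2) unfolding S'_def by (subst orthogonal_commute) blast
    then have "(norm (L u))\<^sup>2 = (norm (fst u))\<^sup>2 + (norm (snd u))\<^sup>2"
      unfolding L_def by (simp add: norm_add_Pythagorean f1 f2)
    then show ?thesis by (simp add: norm_prod_def real_sqrt_unique)
  qed
  ultimately have "orthogonal_transformation L" by (simp add: orthogonal_transformation)
  moreover have "L ` ({0} \<times> UNIV) = S"
  proof -
    have "L ` ({0} \<times> UNIV) = range f1"
      by (force simp: L_def linear_0[OF f2(1)])
    moreover have "range f1 = S"
    proof (rule subspace_dim_equal)
      show "subspace (range f1)" using f1(1) linear_subspace_image subspace_UNIV by blast
      have "inj f1" using f1(3) by (simp add: linear_injective_0[OF f1(1)]) (metis norm_eq_zero)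
      then have "dim (range f1) = CARD('q)"
        using dim_image_eq[OF f1(1), of UNIV] by simp
      then show "dim S \<le> dim (range f1)" using dim by simp
    qed (use f1 S in auto)
    ultimately show ?thesis by simp
  qed
  ultimately show ?thesis using that by blast
qed

text \<open>Negating one coordinate of the first factor reverses orientation there while fixing the
  vertical subspace pointwise, so the transverse plane keeps its place.\<close>

lemma exists_horizontal_reflection:
  obtains R :: "(real^'k::finite) \<times> (real^'q::finite) \<Rightarrow> (real^'k) \<times> (real^'q)"
  where "orthogonal_transformation R" "\<And>u. R (R u) = u" "\<And>y. R (0, y) = (0, y)"
    "\<And>g. det (horiz (R \<circ> g)) = - det (horiz g)"
proof -
  fix i0 :: 'k
  define r :: "real^'k \<Rightarrow> real^'k" where "r t = (\<chi> i. if i = i0 then - t $ i else t $ i)" for t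
  define R :: "(real^'k) \<times> (real^'q) \<Rightarrow> (real^'k) \<times> (real^'q)" where "R u = (r (fst u), snd u)" for u
  have "linear r" by (intro linearI) (auto simp: r_def vec_eq_iff)
  then have "linear R"
    by (intro linearI) (auto simp: R_def linear_add linear_scale)
  moreover have "r t \<bullet> r t = t \<bullet> t" for t
    unfolding inner_vec_def by (rule sum.cong) (auto simp: r_def)
  then have "norm (R u) = norm u" for u
    by (simp add: norm_eq_sqrt_inner R_def inner_prod_def)
  ultimately have "orthogonal_transformation R" by (simp add: orthogonal_transformation)
  moreover have "R (R u) = u" for u by (auto simp: R_def r_def vec_eq_iff prod_eq_iff)
  moreover have "R (0, y) = (0, y)" for y by (auto simp: R_def r_def vec_eq_iff)
  moreover have "det (horiz (R \<circ> g)) = - det (horiz g)" for g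
  proof -
    have "horiz (R \<circ> g) = (\<chi> i. if i = i0 then (-1) *s (horiz g $ i) else horiz g $ i)"
      by (auto simp: horiz_def R_def r_def vec_eq_iff)
    then have "det (horiz (R \<circ> g)) = - det (\<chi> i. if i = i0 then horiz g $ i else horiz g $ i)"
      by (simp add: det_row_mul del: if_cancel)
    then show ?thesis by simp
  qed
  ultimately show ?thesis using that by blast
qed

text \<open>A kernel vector of the horizontal matrix would give a nonzero direction of the plane
  that is vertical in the coordinates \<open>inv L\<close>, hence also a direction of the transverse
  plane.\<close>

lemma transverse_imp_det_nonzero:
  fixes f :: "'k::finite \<Rightarrow> (real^'k) \<times> (real^'q::finite)"
    and L :: "(real^'k) \<times> (real^'q) \<Rightarrow> (real^'k) \<times> (real^'q)"
  assumes L: "orthogonal_transformation L" and fr: "frame f"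
    and tr: "transverse ((\<lambda>u. a + L u) ` ({0} \<times> UNIV)) (fst (oplane p f))"
  shows "det (horiz (inv L \<circ> f)) \<noteq> 0"
proof
  assume "det (horiz (inv L \<circ> f)) = 0"
  then have "\<not> invertible (horiz (inv L \<circ> f))" by (simp add: invertible_det_nz)
  then obtain c where c: "c \<noteq> 0" "horiz (inv L \<circ> f) *v c = 0"
    by (metis invertible_left_inverse matrix_left_invertible_ker)
  have lin: "linear L" and surj: "surj L" and linK: "linear (inv L)"
    using L by (simp_all add: orthogonal_transformation_linear orthogonal_transformation_surj orthogonal_transformation_inv)
  have "fst (inv L (comb f c)) = 0"
    using c(2) by (simp add: horiz_mult linear_comb_image[OF linK])
  then have "comb f c = L (0, snd (inv L (comb f c)))"
    using surj by (metis prod.collapse surj_f_inv_f)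
  then have "comb f c = (a + L (0, snd (inv L (comb f c)))) - (a + L (0, 0))"
    by (simp add: linear_0[OF lin] flip: zero_prod_def)
  then have "comb f c \<in> lin_dir ((\<lambda>u. a + L u) ` ({0} \<times> UNIV))"
    unfolding lin_dir_def by blast
  moreover have "comb f c = (p + comb f c) - (p + comb f 0)"
    by (simp add: linear_0[OF linear_comb])
  then have "comb f c \<in> lin_dir (fst (oplane p f))"
    unfolding lin_dir_def fst_oplane by blast
  ultimately have "comb f c = 0" using tr unfolding transverse_def by blast
  with c(1) fr show False by (simp add: frame_iff)
qed

lemma isometric_parametrization:
  fixes T :: "((real^'k::finite) \<times> (real^'q::finite)) set"
  assumes "affine T" "aff_dim T = int CARD('q)"
  obtains a and L :: "(real^'k) \<times> (real^'q) \<Rightarrow> (real^'k) \<times> (real^'q)"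
  where "orthogonal_transformation L" "(\<lambda>u. a + L u) ` ({0} \<times> UNIV) = T"
proof -
  have "T \<noteq> {}" using assms(2) by auto
  then obtain a where a: "a \<in> T" by blast
  define S where "S = (\<lambda>x. x - a) ` T"
  have "subspace S" unfolding S_def using assms(1) a by (rule affine_diffs_subspace_subtract)
  moreover have "dim S = CARD('q)"
    using aff_dim_dim_affine_diffs[OF assms(1) a] assms(2) by (simp add: S_def)
  ultimately obtain L :: "(real^'k) \<times> (real^'q) \<Rightarrow> (real^'k) \<times> (real^'q)"
    where L: "orthogonal_transformation L" "L ` ({0} \<times> UNIV) = S"
    by (rule vertical_isometry)
  have "(\<lambda>u. a + L u) ` ({0} \<times> UNIV) = (\<lambda>v. a + v) ` S"
    by (simp only: L(2)[symmetric] image_image)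
  also have "\<dots> = T" by (simp add: S_def image_image)
  finally show ?thesis using that L(1) by blast
qed

lemma transverse_fibration_as_graphs:
  fixes F :: "(((real^'k::finite) \<times> (real^'q::finite)) set \<times> ('k \<Rightarrow> (real^'k) \<times> (real^'q)) set) set"
  assumes F: "fibration F" and T: "affine T" "aff_dim T = int CARD('q)"
    and tr: "\<And>P. P \<in> F \<Longrightarrow> transverse T (fst P)"
  obtains B :: "real^'q \<Rightarrow> real^'k^'q" and h
  where "continuous_on UNIV B" "surj h" "\<And>u v. dist (h u) (h v) = dist u v"
    "h ` ({0} \<times> UNIV) = T" "F = transport h ` range (Pl B)"
proof -
  obtain a and L :: "(real^'k) \<times> (real^'q) \<Rightarrow> (real^'k) \<times> (real^'q)"
    where L: "orthogonal_transformation L" and LT: "(\<lambda>u. a + L u) ` ({0} \<times> UNIV) = T"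
    using isometric_parametrization[OF T] by blast
  have nz: "det (horiz (inv L \<circ> f)) \<noteq> 0" if "frame f" "oplane p f \<in> F" for p f
  proof (rule transverse_imp_det_nonzero[OF L that(1)])
    show "transverse ((\<lambda>u. a + L u) ` ({0} \<times> UNIV)) (fst (oplane p f))"
      unfolding LT using that(2) by (rule tr)
  qed
  obtain s :: real where s: "s = 1 \<or> s = -1"
    and sgn: "\<And>p f. frame f \<Longrightarrow> oplane p f \<in> F \<Longrightarrow> s * det (horiz (inv L \<circ> f)) > 0"
    by (rule fibration_constant_sign[OF F orthogonal_transformation_linear[OF orthogonal_transformation_inv[OF L]]])
      (erule (1) nz, rule that)
  \<comment> \<open>\<open>M\<close> is \<open>L\<close> if the common sign is positive and
    \<open>L \<circ> R\<close> otherwise; both carry the vertical subspace onto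
    \<open>T\<close>.\<close>
  obtain M :: "(real^'k) \<times> (real^'q) \<Rightarrow> (real^'k) \<times> (real^'q)" where M: "orthogonal_transformation M" "(\<lambda>u. a + M u) ` ({0} \<times> UNIV) = T"
    "\<And>p f. frame f \<Longrightarrow> oplane p f \<in> F \<Longrightarrow> det (horiz (inv M \<circ> f)) > 0"
  proof (cases "s = 1")
    case True
    show ?thesis
    proof (rule that[OF L LT])
      show "det (horiz (inv L \<circ> f)) > 0" if "frame f" "oplane p f \<in> F" for p f
        using sgn[OF that] True by simp
    qed
  next
    case False
    then have s: "s = -1" using s by simp
    obtain R :: "(real^'k) \<times> (real^'q) \<Rightarrow> (real^'k) \<times> (real^'q)"
      where R: "orthogonal_transformation R" "\<And>u. R (R u) = u" "\<And>y. R (0, y) = (0, y)"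
        "\<And>g. det (horiz (R \<circ> g)) = - det (horiz g)"
      using exists_horizontal_reflection by blast
    \<comment> \<open>Since \<open>R\<close> is an involution, passing to \<open>L \<circ> R\<close>
      composes the coordinate map with \<open>R\<close>, which negates every horizontal
      determinant.\<close>
    have "inv (L \<circ> R) = R \<circ> inv L"
    proof (rule inv_equality)
      show "(R \<circ> inv L) ((L \<circ> R) x) = x" for x
        using orthogonal_transformation_inj[OF L] by (simp add: R(2))
      show "(L \<circ> R) ((R \<circ> inv L) y) = y" for y
        using orthogonal_transformation_surj[OF L] by (simp add: R(2) surj_f_inv_f)
    qed
    then have reflected: "det (horiz (inv (L \<circ> R) \<circ> f)) = - det (horiz (inv L \<circ> f))" for f :: "'k \<Rightarrow> (real^'k) \<times> (real^'q)"
      by (simp only: comp_assoc R(4))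
    have LRT: "(\<lambda>u. a + (L \<circ> R) u) ` ({0} \<times> UNIV) = T"
      unfolding LT[symmetric] by (rule image_cong) (auto simp: R(3))
    show ?thesis
    proof (rule that[OF orthogonal_transformation_compose[OF L R(1)] LRT])
      show "det (horiz (inv (L \<circ> R) \<circ> f)) > 0" if "frame f" "oplane p f \<in> F" for p f
        using sgn[OF that] s by (simp only: reflected)
    qed
  qed
  obtain B :: "real^'q \<Rightarrow> real^'k^'q"
    where B: "continuous_on UNIV B" "F = transport (\<lambda>u. a + M u) ` range (Pl B)"
    by (rule fibration_as_graphs[OF F M(1)]) (erule (1) M(3), rule that)
  have "surj (\<lambda>u. a + M u)"
  proof (rule surjI)
    show "a + M (inv M (x - a)) = x" for x
      using orthogonal_transformation_surj[OF M(1)] by (simp add: surj_f_inv_f)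
  qed
  moreover have "dist (a + M u) (a + M v) = dist u v" for u v
    using orthogonal_transformation_norm[OF M(1), of "u - v"]
    by (simp add: dist_norm linear_diff[OF orthogonal_transformation_linear[OF M(1)]])
  ultimately show ?thesis using that B M(2) by blast
qed

theorem theorem3p15:
  shows "(\<forall>B :: real^'q::finite \<Rightarrow> real^'k::finite^'q.
            continuous_on UNIV B \<longrightarrow>
            ((fibration (range (Pl B)) \<and> skew (range (Pl B))) \<longleftrightarrow>
             ((\<forall>x y. x \<noteq> y \<longrightarrow> {v. Amap B x v - Amap B y v = 0} = {0}) \<and>
              (\<forall>s :: nat \<Rightarrow> real^'q.
                  \<not> (\<exists>z r. strict_mono r \<and> (s \<circ> r) \<longlonglongrightarrow> z) \<longrightarrow>
                  filterlim (\<lambda>m. infdist 0 (fst (Pl B (s m)))) at_top sequentially))))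
       \<and> (\<forall>(F :: (((real^'k) \<times> (real^'q)) set \<times> ('k \<Rightarrow> (real^'k) \<times> (real^'q)) set) set)
             (T :: ((real^'k) \<times> (real^'q)) set).
            fibration F \<and> skew F \<and> affine T \<and> aff_dim T = int CARD('q) \<and>
            (\<forall>P\<in>F. transverse T (fst P)) \<longrightarrow>
            (\<exists>(B :: real^'q \<Rightarrow> real^'k^'q) (h :: (real^'k) \<times> (real^'q) \<Rightarrow> (real^'k) \<times> (real^'q)).
                continuous_on UNIV B \<and> surj h \<and> (\<forall>u v. dist (h u) (h v) = dist u v) \<and>
                h ` ({0} \<times> UNIV) = T \<and> F = transport h ` range (Pl B)))"
proof (rule conjI; intro allI impI)
  fix B :: "real^'q \<Rightarrow> real^'k^'q"
  assume "continuous_on UNIV B"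
  then show "(fibration (range (Pl B)) \<and> skew (range (Pl B))) \<longleftrightarrow>
             ((\<forall>x y. x \<noteq> y \<longrightarrow> {v. Amap B x v - Amap B y v = 0} = {0}) \<and>
              (\<forall>s :: nat \<Rightarrow> real^'q.
                  \<not> (\<exists>z r. strict_mono r \<and> (s \<circ> r) \<longlonglongrightarrow> z) \<longrightarrow>
                  filterlim (\<lambda>m. infdist 0 (fst (Pl B (s m)))) at_top sequentially))"
    by (rule skew_fibration_iff)
next
  fix F :: "(((real^'k) \<times> (real^'q)) set \<times> ('k \<Rightarrow> (real^'k) \<times> (real^'q)) set) set"
    and T :: "((real^'k) \<times> (real^'q)) set"
  assume A: "fibration F \<and> skew F \<and> affine T \<and> aff_dim T = int CARD('q) \<and>
            (\<forall>P\<in>F. transverse T (fst P))"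
  show "\<exists>(B :: real^'q \<Rightarrow> real^'k^'q) (h :: (real^'k) \<times> (real^'q) \<Rightarrow> (real^'k) \<times> (real^'q)).
                continuous_on UNIV B \<and> surj h \<and> (\<forall>u v. dist (h u) (h v) = dist u v) \<and>
                h ` ({0} \<times> UNIV) = T \<and> F = transport h ` range (Pl B)"
    by (rule transverse_fibration_as_graphs[of F T]) (use A in blast)+
qed

end
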